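(* Let $G$ be a metric group with left-invariant distance $d$. If $d$ is bi-invariant, then $L(G)$ is a topological group for the composition law $f_1f_2: t\mapsto f_1(t)f_2(t)$. This is in particular the case if $G$ is commutative or if $d$ is the discrete metric.
   Context: A metric group is a topological group $G$ endowed with a left-invariant distance $d$ (that is, $d(gx,gy)=d(x,y)$) defining its topology; $d$ is bi-invariant if moreover $d(xg,yg)=d(x,y)$. The discrete metric is $d(x,y)=1$ for $x\ne y$, $d(x,x)=0$. $\Omega$ denotes an uncountable standard Borel space endowed with a non-atomic probability measure; integration against it is written $dt$. $L(G)=L(\Omega,G)$ is the set of Borel maps $f:\Omega\to G$ with $\int_\Omega d(f(t),e)\,dt<\infty$ ($e$ the neutral element; the condition is automatic when $G$ is bounded), modulo almost-everywhere equality, with the metric $d(f_1,f_2)=\int_\Omega d(f_1(t),f_2(t))\,dt$. *)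

theory Defs
  imports "HOL-Probability.Probability" "HOL-Algebra.Group"
begin

definition borel_of :: "'a topology \<Rightarrow> 'a measure"
  where "borel_of T = sigma (topspace T) {U. openin T U}"

definition standard_borel :: "'a measure \<Rightarrow> bool"
  where "standard_borel M \<longleftrightarrow>
    (\<exists>T. completely_metrizable_space T \<and> separable_space T \<and>
         space M = topspace T \<and> sets M = sets (borel_of T))"

definition nonatomic :: "'a measure \<Rightarrow> bool"
  where "nonatomic M \<longleftrightarrow>
    (\<forall>A\<in>sets M. emeasure M A > 0 \<longrightarrow>
       (\<exists>B\<in>sets M. B \<subseteq> A \<and> 0 < emeasure M B \<and> emeasure M B < emeasure M A))"

definition topological_group :: "('a, 'b) monoid_scheme \<Rightarrow> 'a topology \<Rightarrow> bool"
  where "topological_group G T \<longleftrightarrow>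
    group G \<and> topspace T = carrier G \<and>
    continuous_map (prod_topology T T) T (\<lambda>(x, y). x \<otimes>\<^bsub>G\<^esub> y) \<and>
    continuous_map T T (\<lambda>x. inv\<^bsub>G\<^esub> x)"

abbreviation metric_topology :: "('a, 'b) monoid_scheme \<Rightarrow> ('a \<Rightarrow> 'a \<Rightarrow> real) \<Rightarrow> 'a topology"
  where "metric_topology G d \<equiv> Metric_space.mtopology (carrier G) d"

definition metric_group :: "('a, 'b) monoid_scheme \<Rightarrow> ('a \<Rightarrow> 'a \<Rightarrow> real) \<Rightarrow> bool"
  where "metric_group G d \<longleftrightarrow>
    Metric_space (carrier G) d \<and> topological_group G (metric_topology G d) \<and>
    (\<forall>g\<in>carrier G. \<forall>x\<in>carrier G. \<forall>y\<in>carrier G. d (g \<otimes>\<^bsub>G\<^esub> x) (g \<otimes>\<^bsub>G\<^esub> y) = d x y)"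

definition bi_invariant :: "('a, 'b) monoid_scheme \<Rightarrow> ('a \<Rightarrow> 'a \<Rightarrow> real) \<Rightarrow> bool"
  where "bi_invariant G d \<longleftrightarrow>
    (\<forall>g\<in>carrier G. \<forall>x\<in>carrier G. \<forall>y\<in>carrier G.
       d (g \<otimes>\<^bsub>G\<^esub> x) (g \<otimes>\<^bsub>G\<^esub> y) = d x y \<and> d (x \<otimes>\<^bsub>G\<^esub> g) (y \<otimes>\<^bsub>G\<^esub> g) = d x y)"

definition is_discrete_metric :: "'a set \<Rightarrow> ('a \<Rightarrow> 'a \<Rightarrow> real) \<Rightarrow> bool"
  where "is_discrete_metric X d \<longleftrightarrow> (\<forall>x\<in>X. \<forall>y\<in>X. d x y = discrete_metric.dd x y)"

definition L_maps :: "'w measure \<Rightarrow> ('a, 'b) monoid_scheme \<Rightarrow> ('a \<Rightarrow> 'a \<Rightarrow> real) \<Rightarrow> ('w \<Rightarrow> 'a) set"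
  where "L_maps M G d =
    {f \<in> measurable M (borel_of (metric_topology G d)). integrable M (\<lambda>t. d (f t) \<one>\<^bsub>G\<^esub>)}"

text \<open>Functions are total on the type, so the classes of this relation also disregard the values
  outside \<^term>\<open>space M\<close>.\<close>

definition L_eq ::
    "'w measure \<Rightarrow> ('a, 'b) monoid_scheme \<Rightarrow> ('a \<Rightarrow> 'a \<Rightarrow> real) \<Rightarrow> (('w \<Rightarrow> 'a) \<times> ('w \<Rightarrow> 'a)) set"
  where "L_eq M G d = {(f, g). f \<in> L_maps M G d \<and> g \<in> L_maps M G d \<and> (AE t in M. f t = g t)}"

text \<open>The operations on classes below are unions over all representatives. That they are
  well defined is not built in: it is part of what \<open>L_is_topological_group\<close> asserts.\<close>

definition L_group :: "'w measure \<Rightarrow> ('a, 'b) monoid_scheme \<Rightarrow> ('a \<Rightarrow> 'a \<Rightarrow> real) \<Rightarrow> ('w \<Rightarrow> 'a) set monoid"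
  where "L_group M G d =
    \<lparr>carrier = L_maps M G d // L_eq M G d,
     mult = (\<lambda>A B. \<Union>f\<in>A. \<Union>g\<in>B. L_eq M G d `` {\<lambda>t. f t \<otimes>\<^bsub>G\<^esub> g t}),
     one = L_eq M G d `` {\<lambda>t. \<one>\<^bsub>G\<^esub>}\<rparr>"

text \<open>The value \<open>0\<close> off the carrier is needed because \<^locale>\<open>Metric_space\<close> demands nonnegativity
  and symmetry of the distance on the whole type.\<close>

definition L_dist ::
    "'w measure \<Rightarrow> ('a, 'b) monoid_scheme \<Rightarrow> ('a \<Rightarrow> 'a \<Rightarrow> real) \<Rightarrow>
     ('w \<Rightarrow> 'a) set \<Rightarrow> ('w \<Rightarrow> 'a) set \<Rightarrow> real"
  where "L_dist M G d A B =
    (if A \<in> carrier (L_group M G d) \<and> B \<in> carrier (L_group M G d)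
     then the_elem (\<Union>f\<in>A. \<Union>g\<in>B. {\<integral>t. d (f t) (g t) \<partial>M}) else 0)"

definition L_is_topological_group :: "'w measure \<Rightarrow> ('a, 'b) monoid_scheme \<Rightarrow> ('a \<Rightarrow> 'a \<Rightarrow> real) \<Rightarrow> bool"
  where "L_is_topological_group M G d \<longleftrightarrow>
    (\<forall>f\<in>L_maps M G d. \<forall>g\<in>L_maps M G d.
       (\<lambda>t. f t \<otimes>\<^bsub>G\<^esub> g t) \<in> L_maps M G d \<and>
       (L_eq M G d `` {f}) \<otimes>\<^bsub>L_group M G d\<^esub> (L_eq M G d `` {g})
         = L_eq M G d `` {\<lambda>t. f t \<otimes>\<^bsub>G\<^esub> g t}) \<and>
    Metric_space (carrier (L_group M G d)) (L_dist M G d) \<and>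
    topological_group (L_group M G d) (metric_topology (L_group M G d) (L_dist M G d))"

end

theory Submission
  imports Defs
begin

text \<open>On classes of functions, everything is pointwise. Write \<open>D\<close> for the integrated distance. If
  \<open>d\<close> is bi-invariant, then \<open>d (xy) (x'y') \<le> d x x' + d y y'\<close> and \<open>d (inv x) (inv y) = d x y\<close>;
  integrating, \<open>D\<close> satisfies the same two relations, so that multiplication of classes is
  Lipschitz and inversion is isometric (lemmas \<open>dist_mult_cls_le\<close> and \<open>dist_inv_cls\<close>). For a
  commutative group right translations are left translations, and for the discrete metric every
  injection is an isometry, so in both cases left invariance yields bi-invariance.

  The difficulty is measurability. If \<open>G\<close> is not separable, open sets of \<open>G \<times> G\<close> need not lie in
  the product of the two Borel \<open>\<sigma>\<close>-algebras, and it is not clear that \<open>t \<mapsto> f t \<cdot> g t\<close> or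
  \<open>t \<mapsto> d (f t) (g t)\<close> is Borel for Borel maps \<open>f\<close> and \<open>g\<close>. What rescues the statement is that a
  Borel map on a standard Borel space has separable image (lemma \<open>measurable_image_separable\<close>),
  since then only countably many products of balls matter.

  The image is separable for a reason of cardinality. Otherwise it contains an uncountable set of
  points at mutual distances at least some \<open>e > 0\<close>; every subset of it is closed and has a Borel
  preimage. Selecting one preimage of each of these points gives a map \<open>c\<close> between Polish spaces
  with uncountable range, for which the preimage of every set whatsoever is Borel. The graph of
  \<open>c\<close> is Borel, so its range is analytic and, by the perfect set theorem, contains a copy of the
  power set of the naturals. The preimages of the subsets of this copy are more Borel sets than
  exist, because a Borel set, as the projection of a closed set, is described by a single set of
  naturals (lemma \<open>countable_range_if_all_preimages_borel\<close>).\<close>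

section \<open>Analytic sets and the number of Borel sets\<close>

text \<open>The classical definition projects along sequences of naturals. These form a closed subset of
  the space of real sequences, which is itself a continuous image of them, so projecting along
  real sequences yields the same sets; real sequences are a complete metric space as they stand.\<close>

definition analytic :: "'a::metric_space set \<Rightarrow> bool" where
  "analytic A \<longleftrightarrow> (\<exists>F :: ('a \<times> (nat \<Rightarrow> real)) set. closed F \<and> A = fst ` F)"

lemma analytic_closed: "closed A \<Longrightarrow> analytic A"
  unfolding analytic_def by (rule exI[of _ "A \<times> UNIV"]) (auto simp: closed_Times)

lemma continuous_on_reindex_snd:
  "continuous_on UNIV (\<lambda>p :: 'a::topological_space \<times> (nat \<Rightarrow> real). (fst p, \<lambda>k. snd p (h k)))"
  by (intro continuous_intros continuous_on_coordinatewise_then_product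
       continuous_on_compose2[OF continuous_on_product_coordinates]) auto

lemma closed_snd_coordinate:
  assumes "closed S"
  shows "closed {p :: 'a::topological_space \<times> (nat \<Rightarrow> real). snd p n \<in> S}"
proof -
  have "continuous_on UNIV (\<lambda>p :: 'a \<times> (nat \<Rightarrow> real). snd p n)"
    by (intro continuous_intros continuous_on_compose2[OF continuous_on_product_coordinates]) auto
  then have "closed ((\<lambda>p :: 'a \<times> (nat \<Rightarrow> real). snd p n) -` S)"
    using assms by (intro closed_vimage)
  then show ?thesis by (simp add: vimage_def)
qed

text \<open>The first coordinate of the witness says to which of the sets the point belongs, and the
  others witness that membership. Restricting the first coordinate to the naturals, a closed
  discrete set of reals, keeps the condition closed.\<close>

lemma analytic_UN:
  fixes A :: "nat \<Rightarrow> 'a::metric_space set"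
  assumes "\<And>n. analytic (A n)"
  shows "analytic (\<Union>n. A n)"
proof -
  obtain F :: "nat \<Rightarrow> ('a \<times> (nat \<Rightarrow> real)) set"
    where F: "\<And>n. closed (F n)" "\<And>n. A n = fst ` F n"
    using assms unfolding analytic_def by metis
  define H where "H = (\<Inter>n. {p. snd p 0 \<in> of_nat ` (-{n})} \<union>
      ({p. snd p 0 \<in> {of_nat n}} \<inter> (\<lambda>p. (fst p, \<lambda>k. snd p (Suc k))) -` F n))"
  have "closed H" unfolding H_def
    by (intro closed_INT ballI closed_Un closed_Int closed_snd_coordinate closed_of_nat_image
        closed_singleton closed_vimage F continuous_on_reindex_snd)
  moreover have "(\<Union>n. A n) = fst ` H"
  proof (intro equalityI subsetI)
    fix x assume "x \<in> (\<Union>n. A n)"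
    then obtain n w where "(x, w) \<in> F n" using F(2) by force
    then have "(x, case_nat (of_nat n) w) \<in> H" by (auto simp: H_def)
    then show "x \<in> fst ` H" by force
  next
    fix x assume "x \<in> fst ` H"
    then obtain w where "(x, w) \<in> H" by force
    then obtain n where "w 0 = of_nat n" by (force simp: H_def)
    with \<open>(x, w) \<in> H\<close> have "(x, \<lambda>k. w (Suc k)) \<in> F n" by (auto simp: H_def)
    then show "x \<in> (\<Union>n. A n)" using F(2) by force
  qed
  ultimately show ?thesis unfolding analytic_def by blast
qed

text \<open>Pairing the indices packs countably many witnesses into one sequence.\<close>

lemma analytic_INT:
  fixes A :: "nat \<Rightarrow> 'a::metric_space set"
  assumes "\<And>n. analytic (A n)"
  shows "analytic (\<Inter>n. A n)"
proof -
  obtain F :: "nat \<Rightarrow> ('a \<times> (nat \<Rightarrow> real)) set"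
    where F: "\<And>n. closed (F n)" "\<And>n. A n = fst ` F n"
    using assms unfolding analytic_def by metis
  define H where "H = (\<Inter>n. (\<lambda>p. (fst p, \<lambda>k. snd p (prod_encode (n, k)))) -` F n)"
  have "closed H" unfolding H_def
    by (intro closed_INT ballI closed_vimage F continuous_on_reindex_snd)
  moreover have "(\<Inter>n. A n) = fst ` H"
  proof (intro equalityI subsetI)
    fix x assume "x \<in> (\<Inter>n. A n)"
    then have "\<forall>n. \<exists>w. (x, w) \<in> F n" using F(2) by force
    then obtain w where w: "\<And>n. (x, w n) \<in> F n" by metis
    have "(x, \<lambda>m. case_prod w (prod_decode m)) \<in> H" by (auto simp: H_def w)
    then show "x \<in> fst ` H" by force
  next
    fix x assume "x \<in> fst ` H"
    then obtain w where "(x, w) \<in> H" by force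
    then have "(x, \<lambda>k. w (prod_encode (n, k))) \<in> F n" for n by (auto simp: H_def)
    then show "x \<in> (\<Inter>n. A n)" using F(2) by force
  qed
  ultimately show ?thesis unfolding analytic_def by blast
qed

lemma analytic_open:
  assumes "open U"
  shows "analytic U"
proof -
  define K where "K n = {x. \<forall>y\<in>-U. 1 / real (Suc n) \<le> dist x y}" for n
  have "closed (K n)" for n
  proof -
    have "K n = (\<Inter>y\<in>-U. {x. 1 / real (Suc n) \<le> dist x y})" by (auto simp: K_def)
    then show ?thesis by (auto intro!: closed_INT closed_Collect_le continuous_intros)
  qed
  moreover have "U = (\<Union>n. K n)"
  proof (intro equalityI subsetI)
    fix x assume "x \<in> U"
    then obtain e where "e > 0" and e: "\<And>y. dist y x < e \<Longrightarrow> y \<in> U"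
      using assms unfolding open_dist by blast
    obtain n where n: "1 / real (Suc n) < e"
      using \<open>e > 0\<close> nat_approx_posE by blast
    have "x \<in> K n" unfolding K_def using e n by (force simp: dist_commute)
    then show "x \<in> (\<Union>n. K n)" by blast
  next
    fix x assume "x \<in> (\<Union>n. K n)"
    then obtain n where n: "x \<in> K n" by blast
    show "x \<in> U"
    proof (rule ccontr)
      assume "x \<notin> U"
      then have "1 / real (Suc n) \<le> dist x x" using n unfolding K_def by blast
      then show False by simp
    qed
  qed
  ultimately show ?thesis by (metis analytic_UN analytic_closed)
qed

text \<open>Complements of analytic sets need not be analytic, so the induction over the \<open>\<sigma>\<close>-algebra
  carries a set along with its complement.\<close>

lemma borel_imp_analytic:
  assumes "A \<in> sets (borel :: 'a::metric_space measure)"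
  shows "analytic A"
proof -
  have "A \<in> sigma_sets UNIV {S::'a set. open S}" using assms by (simp add: borel_def)
  then have "analytic A \<and> analytic (- A)"
  proof induction
    case (Basic a) then show ?case by (auto intro: analytic_open analytic_closed)
  next
    case Empty then show ?case by (auto intro: analytic_closed)
  next
    case (Compl a) then show ?case by (simp add: Compl_eq_Diff_UNIV[symmetric])
  next
    case (Union a) then show ?case by (auto intro: analytic_UN analytic_INT simp: Compl_UN)
  qed
  then show ?thesis by simp
qed

text \<open>There are at most continuum many Borel sets: each is the projection of a closed set, and the
  complement of a closed set is determined by the set of indices of basic open sets that it
  contains.\<close>

lemma borel_sets_indexed:
  "\<exists>\<Phi> :: nat set \<Rightarrow> 'a::{metric_space, second_countable_topology} set. sets borel \<subseteq> range \<Phi>"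
proof -
  obtain \<B> :: "('a \<times> (nat \<Rightarrow> real)) set set" where "countable \<B>" and b: "topological_basis \<B>"
    using ex_countable_basis by blast
  define B where "B = from_nat_into \<B>"
  have B: "\<exists>U. S = \<Union> (B ` U)" if S: "open S" for S
  proof -
    have "\<exists>\<C>\<subseteq>\<B>. \<Union>\<C> = S" using b S by (simp add: topological_basis_def)
    then obtain \<C> where \<C>: "\<C> \<subseteq> \<B>" "\<Union>\<C> = S" by blast
    have "B (to_nat_on \<B> C) = C" if "C \<in> \<C>" for C
      using \<C>(1) that \<open>countable \<B>\<close> by (simp add: B_def subset_iff)
    then have "B ` to_nat_on \<B> ` \<C> = \<C>" by (simp add: image_image)
    then show ?thesis using \<C>(2) by metis
  qed
  have "A \<in> range (\<lambda>U. fst ` (- \<Union> (B ` U)))" if A: "A \<in> sets borel" for A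
  proof -
    obtain F :: "('a \<times> (nat \<Rightarrow> real)) set" where F: "closed F" "A = fst ` F"
      using borel_imp_analytic[OF A] unfolding analytic_def by blast
    obtain U where U: "- F = \<Union> (B ` U)" using B[OF open_Compl[OF F(1)]] by blast
    have "A = fst ` (- \<Union> (B ` U))" by (simp add: F(2) U[symmetric])
    then show ?thesis by blast
  qed
  then show ?thesis by blast
qed

section \<open>The perfect set theorem for analytic sets\<close>

text \<open>The points that have a neighbourhood meeting \<open>E\<close> in a countable set lie in countably many
  basic open sets, each of which meets \<open>E\<close> in a countable set, so all but countably many points of
  \<open>E\<close> are condensation points.\<close>

lemma two_condensation_points:
  fixes E :: "'a::{metric_space, second_countable_topology} set"
  assumes "uncountable E"
  obtains y z where "y \<noteq> z" "\<And>U. open U \<Longrightarrow> y \<in> U \<or> z \<in> U \<Longrightarrow> uncountable (E \<inter> U)"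
proof -
  obtain \<B> :: "'a set set" where "countable \<B>" and b: "topological_basis \<B>"
    using ex_countable_basis by blast
  define N where "N = (\<Union>S \<in> {S\<in>\<B>. countable (E \<inter> S)}. E \<inter> S)"
  have "countable N" unfolding N_def using \<open>countable \<B>\<close>
    by (intro countable_UN countable_subset[OF _ \<open>countable \<B>\<close>]) auto
  then have unc: "uncountable (E - N)" using assms uncountable_minus_countable by blast
  then obtain y where y: "y \<in> E - N" by (metis countable_empty ex_in_conv)
  have "uncountable (E - N - {y})" using unc by (simp add: uncountable_minus_countable)
  then obtain z where z: "z \<in> E - N" "z \<noteq> y" by (metis DiffE countable_empty ex_in_conv singletonI)
  have "uncountable (E \<inter> U)" if x: "open U" "x \<in> U" "x \<in> E - N" for x U
  proof
    assume "countable (E \<inter> U)"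
    obtain S where S: "S \<in> \<B>" "x \<in> S" "S \<subseteq> U" using topological_basisE[OF b x(1,2)] by blast
    then have "countable (E \<inter> S)" using \<open>countable (E \<inter> U)\<close> by (meson Int_mono countable_subset order_refl)
    then show False using S x(3) unfolding N_def by blast
  qed
  then show ?thesis using that[of y z] y z by blast
qed

text \<open>One step of a Cantor scheme. Disjoint closed balls around two condensation points of the
  image give two closed pieces whose images are uncountable and disjoint; covering a piece by
  countably many small balls, one of the balls must retain an uncountable image.\<close>

lemma split_closed:
  fixes k :: "'p::{metric_space, second_countable_topology} \<Rightarrow> 'b::{metric_space, second_countable_topology}"
  assumes "closed K" "continuous_on UNIV k" "uncountable (k ` K)" "e > 0"
  shows "\<exists>L. \<forall>b::bool. closed (L b) \<and> L b \<subseteq> K \<and> uncountable (k ` L b) \<and>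
           (\<forall>x\<in>L b. \<forall>y\<in>L b. dist x y \<le> e) \<and> k ` L True \<inter> k ` L False = {}"
proof -
  obtain D :: "'p set" where "countable D" and D: "\<And>X. open X \<Longrightarrow> X \<noteq> {} \<Longrightarrow> \<exists>d\<in>D. d \<in> X"
    using countable_dense_setE by blast
  have shrink: "\<exists>L. closed L \<and> L \<subseteq> K \<and> uncountable (k ` L) \<and> k ` L \<subseteq> C \<and> (\<forall>x\<in>L. \<forall>y\<in>L. dist x y \<le> e)"
    if C: "closed C" "uncountable (k ` K \<inter> C)" for C
  proof -
    have "k ` K \<inter> C = (\<Union>d\<in>D. k ` (K \<inter> k -` C \<inter> cball d (e/2)))"
    proof (intro equalityI subsetI)
      fix y assume "y \<in> k ` K \<inter> C"
      then obtain x where x: "x \<in> K" "y = k x" "k x \<in> C" by blast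
      obtain d where "d \<in> D" "d \<in> ball x (e/2)" using D[of "ball x (e/2)"] \<open>e > 0\<close> by auto
      then show "y \<in> (\<Union>d\<in>D. k ` (K \<inter> k -` C \<inter> cball d (e/2)))"
        using x by (force simp: dist_commute)
    qed auto
    then obtain d where d: "uncountable (k ` (K \<inter> k -` C \<inter> cball d (e/2)))"
      using C(2) \<open>countable D\<close> countable_UN by (metis (no_types, lifting))
    have "closed (K \<inter> k -` C \<inter> cball d (e/2))"
      using assms C by (intro closed_Int closed_vimage) auto
    moreover have "dist x y \<le> e" if "x \<in> cball d (e/2)" "y \<in> cball d (e/2)" for x y
    proof -
      have "dist x y \<le> dist d x + dist d y" by (metis dist_commute dist_triangle)
      then show ?thesis using that by auto
    qed
    ultimately show ?thesis using d by (intro exI[of _ "K \<inter> k -` C \<inter> cball d (e/2)"]) auto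
  qed
  obtain y z where "y \<noteq> z" and cond: "\<And>U. open U \<Longrightarrow> y \<in> U \<or> z \<in> U \<Longrightarrow> uncountable (k ` K \<inter> U)"
    using two_condensation_points[OF assms(3)] by blast
  define r where "r = dist y z / 3"
  have "r > 0" using \<open>y \<noteq> z\<close> by (simp add: r_def)
  have big: "uncountable (k ` K \<inter> cball y r)" "uncountable (k ` K \<inter> cball z r)"
    using cond[of "ball y r"] cond[of "ball z r"] \<open>r > 0\<close>
    by (meson ball_subset_cball centre_in_ball countable_subset Int_mono open_ball order_refl)+
  obtain L1 where L1: "closed L1" "L1 \<subseteq> K" "uncountable (k ` L1)" "k ` L1 \<subseteq> cball y r"
      "\<forall>x\<in>L1. \<forall>y\<in>L1. dist x y \<le> e"
    using shrink[OF closed_cball big(1)] by (elim exE conjE) (rule that)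
  obtain L2 where L2: "closed L2" "L2 \<subseteq> K" "uncountable (k ` L2)" "k ` L2 \<subseteq> cball z r"
      "\<forall>x\<in>L2. \<forall>y\<in>L2. dist x y \<le> e"
    using shrink[OF closed_cball big(2)] by (elim exE conjE) (rule that)
  have "cball y r \<inter> cball z r = {}"
  proof -
    have False if "dist y x \<le> r" "dist z x \<le> r" for x
      using that dist_triangle[of y z x] \<open>r > 0\<close> unfolding r_def dist_commute[of x z]
      by linarith
    then show ?thesis by auto
  qed
  then have "k ` L1 \<inter> k ` L2 = {}" using L1(4) L2(4) by blast
  then show ?thesis
    using L1 L2 by (intro exI[of _ "\<lambda>b. if b then L1 else L2"]) auto
qed

text \<open>Iterating the splitting along the membership function of a set \<open>N\<close> of naturals gives nested
  closed sets that shrink to a single point. At the least number in which two sets differ, the two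
  branches enter pieces with disjoint images.\<close>

lemma uncountable_image_contains_continuum:
  fixes k :: "'p::{complete_space, second_countable_topology} \<Rightarrow> 'b::{metric_space, second_countable_topology}"
  assumes "closed F" "continuous_on UNIV k" "uncountable (k ` F)"
  shows "\<exists>\<iota> :: nat set \<Rightarrow> 'b. inj \<iota> \<and> range \<iota> \<subseteq> k ` F"
proof -
  define big where "big K \<longleftrightarrow> closed K \<and> uncountable (k ` K)" for K
  have "\<exists>L. \<forall>b::bool. big (L b) \<and> L b \<subseteq> K \<and>
           (\<forall>x\<in>L b. \<forall>y\<in>L b. dist x y \<le> 1 / real (Suc n)) \<and> k ` L True \<inter> k ` L False = {}"
    if "big K" for K n
    using split_closed[of K k "1 / real (Suc n)"] that assms(2)
    unfolding big_def by (metis of_nat_0_less_iff zero_less_Suc zero_less_divide_1_iff)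
  then obtain L where L: "\<And>K n b. big K \<Longrightarrow> big (L K n b)" "\<And>K n b. big K \<Longrightarrow> L K n b \<subseteq> K"
    "\<And>K n b x y. big K \<Longrightarrow> x \<in> L K n b \<Longrightarrow> y \<in> L K n b \<Longrightarrow> dist x y \<le> 1 / real (Suc n)"
    "\<And>K n. big K \<Longrightarrow> k ` L K n True \<inter> k ` L K n False = {}"
    by metis
  define K where "K N = rec_nat F (\<lambda>n S. L S n (n \<in> N))" for N
  have K0: "K N 0 = F" and KS: "K N (Suc n) = L (K N n) n (n \<in> N)" for N n
    by (simp_all add: K_def)
  have bigK: "big (K N n)" for N n
    by (induction n) (use assms in \<open>auto simp: K0 KS L big_def[of F]\<close>)
  have dec: "K N n \<subseteq> K N m" if "m \<le> n" for N m n
    using that by (rule lift_Suc_antimono_le[rotated]) (simp add: KS L bigK)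
  have "\<exists>a. \<forall>n. a \<in> K N n" for N
  proof -
    have "\<exists>n. \<forall>x\<in>K N n. \<forall>y\<in>K N n. dist x y < e" if "e > 0" for e
    proof -
      obtain n where n: "1 / real (Suc n) < e" using \<open>e > 0\<close> nat_approx_posE by blast
      then show ?thesis
        by (intro exI[of _ "Suc n"]) (use L(3)[OF bigK] in \<open>fastforce simp: KS\<close>)
    qed
    moreover have "K N n \<noteq> {}" for n using bigK[of N n] by (auto simp: big_def)
    ultimately show ?thesis
      using decreasing_closed_nest[of "K N"] dec bigK unfolding big_def by metis
  qed
  then obtain p where p: "\<And>N n. p N \<in> K N n" by metis
  have "inj (\<lambda>N. k (p N))"
  proof (rule injI, rule ccontr)
    fix N N' assume eq: "k (p N) = k (p N')" and "N \<noteq> N'"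
    then have ex: "\<exists>n. (n \<in> N) \<noteq> (n \<in> N')" by blast
    define n where "n = (LEAST n. (n \<in> N) \<noteq> (n \<in> N'))"
    have n: "(n \<in> N) \<noteq> (n \<in> N')" unfolding n_def by (rule LeastI_ex[OF ex])
    have "m \<le> n \<Longrightarrow> K N m = K N' m" for m
    proof (induction m)
      case (Suc m)
      then have "(m \<in> N) = (m \<in> N')" using not_less_Least[of m "\<lambda>n. (n \<in> N) \<noteq> (n \<in> N')"] by (auto simp: n_def)
      then show ?case using Suc by (simp add: KS)
    qed (simp add: K0)
    then have "K N n = K N' n" by simp
    then have "k (p N) \<in> k ` L (K N n) n (n \<in> N)" "k (p N') \<in> k ` L (K N n) n (n \<in> N')"
      using p[of N "Suc n"] p[of N' "Suc n"] by (simp_all add: KS)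
    then show False using L(4)[OF bigK[of N n], of n] n eq by (cases "n \<in> N") auto
  qed
  moreover have "k (p N) \<in> k ` F" for N using p[of N 0] by (simp add: K0)
  ultimately show ?thesis by blast
qed

text \<open>If the range were uncountable, it would contain an injective copy of the power set of the
  naturals, and every family \<open>A\<close> of sets of naturals could be recovered from the Borel preimage of
  its copy. As Borel sets are indexed by sets of naturals, this contradicts Cantor's theorem.\<close>

lemma countable_range_if_all_preimages_borel:
  fixes c :: "'a::{complete_space, second_countable_topology} \<Rightarrow> 'b::{complete_space, second_countable_topology}"
  assumes pre: "\<And>A. c -` A \<in> sets borel"
  shows "countable (range c)"
proof (rule ccontr)
  assume unc: "uncountable (range c)"
  have c: "c \<in> borel_measurable borel" by (intro measurableI) (use pre in auto)
  have "{p. c (fst p) = snd p} \<in> sets (borel \<Otimes>\<^sub>M borel :: ('a \<times> 'b) measure)"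
  proof -
    have "{p \<in> space (borel \<Otimes>\<^sub>M borel :: ('a \<times> 'b) measure). c (fst p) = snd p}
            \<in> sets (borel \<Otimes>\<^sub>M borel :: ('a \<times> 'b) measure)"
      using c by measurable
    then show ?thesis by (simp add: space_pair_measure)
  qed
  then have "analytic {p. c (fst p) = snd p}"
    by (intro borel_imp_analytic) (simp only: borel_prod)
  then obtain F :: "(('a \<times> 'b) \<times> (nat \<Rightarrow> real)) set"
    where F: "closed F" "{p. c (fst p) = snd p} = fst ` F"
    unfolding analytic_def by blast
  \<comment> \<open>Projecting the graph to its second component makes the range a continuous image of \<open>F\<close>.\<close>
  have ran: "range c = (\<lambda>q. snd (fst q)) ` F"
  proof -
    have "range c = snd ` {p. c (fst p) = snd p}" by (auto simp: image_iff)
    then show ?thesis by (simp add: F(2) image_image)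
  qed
  have "\<exists>\<iota> :: nat set \<Rightarrow> 'b. inj \<iota> \<and> range \<iota> \<subseteq> (\<lambda>q. snd (fst q)) ` F"
    by (rule uncountable_image_contains_continuum[OF F(1)])
       (use unc in \<open>auto simp: ran intro!: continuous_intros\<close>)
  then obtain \<iota> :: "nat set \<Rightarrow> 'b" where \<iota>: "inj \<iota>" "range \<iota> \<subseteq> range c" unfolding ran by blast
  obtain \<Phi> :: "nat set \<Rightarrow> 'a set" where \<Phi>: "sets borel \<subseteq> range \<Phi>" using borel_sets_indexed by blast
  have "A \<in> range (\<lambda>N. \<iota> -` c ` \<Phi> N)" for A :: "nat set set"
  proof -
    obtain N where N: "c -` (\<iota> ` A) = \<Phi> N" using subsetD[OF \<Phi> pre[of "\<iota> ` A"]] by (elim rangeE)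
    have "\<iota> ` A \<subseteq> range c" using \<iota>(2) by blast
    then have "\<iota> -` c ` \<Phi> N = \<iota> -` \<iota> ` A" by (simp add: N[symmetric] image_vimage_eq Int_absorb2)
    then have "A = \<iota> -` c ` \<Phi> N" by (simp add: inj_vimage_image_eq \<iota>(1))
    then show ?thesis by blast
  qed
  then have "range (\<lambda>N. \<iota> -` c ` \<Phi> N) = Pow UNIV" by blast
  then show False using Cantors_theorem by blast
qed

section \<open>The Borel structure of a topology\<close>

lemma measurable_borel_ofI:
  assumes "f \<in> space M \<rightarrow> topspace T" "\<And>U. openin T U \<Longrightarrow> f -` U \<inter> space M \<in> sets M"
  shows "f \<in> measurable M (borel_of T)"
  unfolding borel_of_def using assms by (intro measurable_measure_of) (auto dest: openin_subset)

lemma space_borel_of [simp]: "space (borel_of T) = topspace T"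
  unfolding borel_of_def by (rule space_measure_of) (auto dest: openin_subset)

lemma openin_in_sets_borel_of: "openin T U \<Longrightarrow> U \<in> sets (borel_of T)"
  unfolding borel_of_def by (subst sets_measure_of) (auto dest: openin_subset)

lemma closedin_in_sets_borel_of:
  assumes "closedin T C"
  shows "C \<in> sets (borel_of T)"
proof -
  have "topspace T - (topspace T - C) \<in> sets (borel_of T)"
    using sets.compl_sets[OF openin_in_sets_borel_of[of T "topspace T - C"]] assms
    by (simp add: closedin_def)
  then show ?thesis using closedin_subset[OF assms] by (simp add: double_diff)
qed

lemma continuous_map_imp_measurable:
  assumes "continuous_map X Y h"
  shows "h \<in> measurable (borel_of X) (borel_of Y)"
proof (rule measurable_borel_ofI)
  show "h \<in> space (borel_of X) \<rightarrow> topspace Y"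
    using assms by (auto simp: continuous_map_def)
  show "h -` U \<inter> space (borel_of X) \<in> sets (borel_of X)" if "openin Y U" for U
  proof -
    have "h -` U \<inter> space (borel_of X) = {x \<in> topspace X. h x \<in> U}" by auto
    then show ?thesis
      using openin_in_sets_borel_of openin_continuous_map_preimage[OF assms that] by metis
  qed
qed

section \<open>Images of Borel maps on standard Borel spaces\<close>

lemma (in Metric_space) fast_Cauchy_converges:
  assumes "mcomplete" "range s \<subseteq> M" and step: "\<And>n. d (s n) (s (Suc n)) \<le> (1/2)^n"
  shows "\<exists>l\<in>M. \<forall>n. d (s n) l \<le> 2 * (1/2)^n"
proof -
  have sM: "s n \<in> M" for n using assms(2) by blast
  have tail: "d (s m) (s (m + k)) \<le> 2 * (1/2)^m - 2 * (1/2)^(m + k)" for m k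
  proof (induction k)
    case (Suc k)
    have "d (s m) (s (m + Suc k)) \<le> d (s m) (s (m + k)) + d (s (m + k)) (s (Suc (m + k)))"
      using triangle[of "s m" "s (m + k)" "s (Suc (m + k))"] sM by simp
    also have "\<dots> \<le> 2 * (1/2)^m - 2 * (1/2)^(m + k) + (1/2)^(m + k)"
      using Suc step[of "m + k"] by linarith
    also have "\<dots> = 2 * (1/2)^m - 2 * (1/2)^(m + Suc k)" by simp
    finally show ?case .
  qed (simp add: sM)
  have le: "d (s m) (s n) \<le> 2 * (1/2)^m" if "m \<le> n" for m n
  proof -
    have "0 \<le> (1/2::real)^n" by simp
    then show ?thesis using tail[of m "n - m"] that by (simp del: zero_le_power)
  qed
  have "MCauchy s"
    unfolding MCauchy_def
  proof (intro conjI allI impI)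
    fix e :: real assume "e > 0"
    then obtain N where N: "(1/2::real)^N < e / 4" using real_arch_pow_inv[of "e/4" "1/2"] by auto
    have "d (s n) (s n') < e" if "N \<le> n" "N \<le> n'" for n n'
    proof -
      have "d (s n) (s n') \<le> d (s N) (s n) + d (s N) (s n')"
        using triangle''[of "s n" "s N" "s n'"] sM by simp
      then show ?thesis using le[OF that(1)] le[OF that(2)] N by linarith
    qed
    then show "\<exists>N. \<forall>n n'. N \<le> n \<longrightarrow> N \<le> n' \<longrightarrow> d (s n) (s n') < e" by blast
  qed (rule assms(2))
  then obtain l where l: "limitin mtopology s l sequentially" using assms(1) mcomplete_def by blast
  then have lM: "l \<in> M" by (simp add: limitin_metric)
  have "d (s n) l \<le> 2 * (1/2)^n" for n
  proof (rule field_le_epsilon)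
    fix e :: real assume "e > 0"
    then have "eventually (\<lambda>m. d (s m) l < e) sequentially"
      using l by (auto simp: limitin_metric elim: eventually_mono)
    then obtain m where m: "m \<ge> n" "d (s m) l < e"
      unfolding eventually_sequentially by (metis nat_le_linear order_refl)
    have "d (s n) l \<le> d (s n) (s m) + d (s m) l" using triangle sM lM by blast
    then show "d (s n) l \<le> 2 * (1/2)^n + e" using le[OF m(1)] m(2) by linarith
  qed
  then show ?thesis using lM by blast
qed

text \<open>Every real sequence \<open>y\<close> is read as a sequence of naturals, hence as a sequence \<open>s\<close> in a
  countable dense set; if \<open>s\<close> is rapidly Cauchy, \<open>y\<close> is sent to its limit. With error bounds known
  in advance, the limit lies in an open set \<open>U\<close> iff for some \<open>n\<close> the closed ball that \<open>s n\<close>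
  guarantees to contain the limit lies in \<open>U\<close>. That condition depends on one coordinate of \<open>y\<close>
  only, so the preimage of \<open>U\<close> is Borel. The lemma moves questions on an abstract standard Borel
  space to a concrete Polish type.\<close>

lemma standard_borel_measurable_image:
  fixes M :: "'w measure"
  assumes "standard_borel M" "space M \<noteq> {}"
  shows "\<exists>\<pi> \<in> measurable (borel :: (nat \<Rightarrow> real) measure) M. range \<pi> = space M"
proof -
  obtain T where T: "completely_metrizable_space T" "separable_space T"
    and M: "space M = topspace T" "sets M = sets (borel_of T)"
    using assms(1) unfolding standard_borel_def by blast
  obtain X d where "Metric_space X d" and compl: "Metric_space.mcomplete X d"
    and TX: "T = Metric_space.mtopology X d"
    using T(1) unfolding completely_metrizable_space_def by blast
  interpret Metric_space X d by fact
  have X: "space M = X" by (simp add: M(1) TX)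
  obtain C where C: "countable C" "C \<subseteq> X" "mtopology closure_of C = X"
    using T(2) unfolding separable_space_def TX by auto
  have C_ne: "C \<noteq> {}"
  proof
    assume "C = {}"
    then have "mtopology closure_of C = {}" by (simp only: closure_of_empty)
    then show False using C(3) assms(2) X by metis
  qed
  define a where "a = from_nat_into C"
  have aX: "a n \<in> X" for n using subsetD[OF C(2) from_nat_into[OF C_ne]] by (simp add: a_def)
  have dense: "\<exists>n. d (a n) x < e" if x: "x \<in> X" "e > 0" for x e
  proof -
    obtain y where "y \<in> C" "d x y < e" 
    proof -
      have "x \<in> mtopology closure_of C" using x(1) by (simp only: C(3))
      then show thesis using x(2) that unfolding metric_closure_of by auto
    qed
    then show ?thesis using C(1) unfolding a_def by (metis commute from_nat_into_to_nat_on)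
  qed
  define h where "h n y = nat \<lfloor>y n :: real\<rfloor>" for n and y :: "nat \<Rightarrow> real"
  have h_meas: "{y. h n y \<in> S} \<in> sets borel" for n S
  proof -
    have "h n \<in> measurable borel (count_space UNIV)"
      unfolding h_def by measurable
    from measurable_sets[OF this, of S] show ?thesis by (simp add: vimage_def)
  qed
  define R where "R = {y. \<forall>n. d (a (h n y)) (a (h (Suc n) y)) \<le> (1/2)^n}"
  have R_meas: "R \<in> sets borel"
  proof -
    have "R = (\<Inter>n. \<Union>i. {y. h n y \<in> {i}} \<inter> {y. h (Suc n) y \<in> {j. d (a i) (a j) \<le> (1/2)^n}})"
      unfolding R_def by auto
    also have "\<dots> \<in> sets borel"
      by (intro sets.countable_INT sets.countable_UN sets.Int image_subsetI h_meas) auto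
    finally show ?thesis .
  qed
  define lim where "lim y l \<longleftrightarrow> l \<in> X \<and> (\<forall>n. d (a (h n y)) l \<le> 2 * (1/2)^n)" for y l
  have lim_unique: "l = l'" if "lim y l" "lim y l'" for y l l'
  proof -
    have "d l l' \<le> 0"
    proof (rule field_le_epsilon)
      fix e :: real assume "e > 0"
      then obtain n where n: "(1/2::real)^n < e / 4" using real_arch_pow_inv[of "e/4" "1/2"] by auto
      have "d l l' \<le> d (a (h n y)) l + d (a (h n y)) l'"
        using triangle''[of l "a (h n y)" l'] that aX by (simp add: lim_def)
      also have "\<dots> \<le> 2 * (1/2)^n + 2 * (1/2)^n" using that unfolding lim_def by (meson add_mono)
      finally show "d l l' \<le> 0 + e" using n by linarith
    qed
    then have "d l l' = 0" using nonneg[of l l'] by linarith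
    then show ?thesis using that by (simp add: lim_def)
  qed
  have lim_ex: "\<exists>l. lim y l" if "y \<in> R" for y
    using fast_Cauchy_converges[OF compl, of "\<lambda>n. a (h n y)"] that aX
    unfolding lim_def R_def by blast
  define \<pi> where "\<pi> y = (if y \<in> R then SOME l. lim y l else a 0)" for y
  have \<pi>_lim: "lim y (\<pi> y)" if "y \<in> R" for y
    using someI_ex[OF lim_ex[OF that]] that by (simp add: \<pi>_def)
  have \<pi>X: "\<pi> y \<in> X" for y using \<pi>_lim[of y] aX by (cases "y \<in> R") (auto simp: lim_def \<pi>_def)
  have "X \<subseteq> range \<pi>"
  proof
    fix x assume x: "x \<in> X"
    \<comment> \<open>Half of the allowed step, since consecutive terms are compared through \<open>x\<close>.\<close>
    have "\<exists>i. d (a i) x < (1/2)^n / 2" for n by (rule dense[OF x]) simp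
    then obtain i where i: "\<And>n. d (a (i n)) x < (1/2)^n / 2" by metis
    define y where "y n = real (i n)" for n
    have hy: "h n y = i n" for n by (simp add: h_def y_def)
    have "d (a (i n)) (a (i (Suc n))) \<le> (1/2)^n" for n
    proof -
      have "d (a (i n)) (a (i (Suc n))) \<le> d (a (i n)) x + d (a (i (Suc n))) x"
        using triangle' aX x by blast
      moreover have "(1/2::real)^Suc n / 2 \<le> (1/2)^n / 2" by simp
      ultimately show ?thesis using i[of n] i[of "Suc n"] by linarith
    qed
    then have "y \<in> R" by (simp add: R_def hy)
    moreover have "lim y x"
      unfolding lim_def hy
    proof (intro conjI allI x)
      fix n show "d (a (i n)) x \<le> 2 * (1/2)^n"
        using i[of n] zero_le_power[of "1/2::real" n] by linarith
    qed
    ultimately have "\<pi> y = x" using lim_unique \<pi>_lim by blast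
    then show "x \<in> range \<pi>" by blast
  qed
  then have ran: "range \<pi> = space M" using \<pi>X X by auto
  have "\<pi> \<in> measurable borel (borel_of T)"
  proof (rule measurable_borel_ofI)
    fix U assume U: "openin T U"
    define S where "S n = {i. mcball (a i) (2 * (1/2)^n) \<subseteq> U}" for n :: nat
    have iff: "\<pi> y \<in> U \<longleftrightarrow> (\<exists>n. h n y \<in> S n)" if y: "y \<in> R" for y
    proof
      assume "\<pi> y \<in> U"
      then obtain r where r: "r > 0" "mball (\<pi> y) r \<subseteq> U"
        using U unfolding TX openin_mtopology by blast
      then obtain n where n: "(1/2::real)^n < r / 4" using real_arch_pow_inv[of "r/4" "1/2"] by auto
      \<comment> \<open>Points of the closed ball are within twice its radius of the limit, that is, within \<open>4 * (1/2)^n\<close>.\<close>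
      have "mcball (a (h n y)) (2 * (1/2)^n) \<subseteq> mball (\<pi> y) r"
        by (rule mcball_subset_mball) (use \<pi>_lim[OF y] \<pi>X n in \<open>auto simp: lim_def intro: le_less_trans[of _ "2 * (1/2)^n + 2 * (1/2)^n"]\<close>)
      then show "\<exists>n. h n y \<in> S n" using r(2) unfolding S_def by blast
    next
      assume "\<exists>n. h n y \<in> S n"
      then show "\<pi> y \<in> U" using \<pi>_lim[OF y] aX by (auto simp: S_def lim_def subset_iff)
    qed
    have "\<pi> -` U = (R \<inter> (\<Union>n. {y. h n y \<in> S n})) \<union> (if a 0 \<in> U then - R else {})"
      using iff by (auto simp: \<pi>_def split: if_splits)
    moreover have "(\<Union>n. {y. h n y \<in> S n}) \<in> sets borel" using h_meas by blast
    ultimately show "\<pi> -` U \<inter> space borel \<in> sets borel"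
      using R_meas by (auto simp: borel_comp)
  qed (use \<pi>X TX in auto)
  then have "\<pi> \<in> measurable borel M" using M by (metis measurable_cong_sets)
  then show ?thesis using ran by blast
qed

text \<open>A maximal set of points of the image at mutual distances at least \<open>e\<close> is \<open>e\<close>-dense in the
  image. It is countable: all its subsets are closed, so a map that selects preimages of its
  points has only Borel preimages. Taking \<open>e = 1 / (n + 1)\<close> for all \<open>n\<close> gives a countable set that
  approximates the image.\<close>

lemma (in Metric_space) measurable_image_separable:
  assumes "standard_borel N" and f: "f \<in> measurable N (borel_of mtopology)"
  shows "\<exists>Q. countable Q \<and> Q \<subseteq> M \<and> (\<forall>t\<in>space N. \<forall>e>0. \<exists>q\<in>Q. d q (f t) < e)"
proof (cases "space N = {}")
  case True then show ?thesis by (intro exI[of _ "{}"]) auto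
next
  case False
  obtain \<pi> :: "(nat \<Rightarrow> real) \<Rightarrow> 'b" where \<pi>: "\<pi> \<in> measurable borel N" "range \<pi> = space N"
    using standard_borel_measurable_image[OF assms(1) False] by blast
  define g where "g = f \<circ> \<pi>"
  have g: "g \<in> measurable borel (borel_of mtopology)" unfolding g_def using \<pi>(1) f by (rule measurable_comp)
  have gran: "range g = f ` space N" unfolding g_def image_comp[symmetric] \<pi>(2) ..
  have fM: "f t \<in> M" if "t \<in> space N" for t using measurable_space[OF f that] by simp
  define sep where "sep e D \<longleftrightarrow> D \<subseteq> range g \<and> (\<forall>x\<in>D. \<forall>y\<in>D. x \<noteq> y \<longrightarrow> e \<le> d x y)" for e D
  have sep_countable: "countable D" if D: "sep e D" and e: "e > 0" for D e
  proof -
    have DM: "D \<subseteq> M" using D gran fM by (auto simp: sep_def)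
    have pre: "g -` E \<in> sets borel" if E: "E \<subseteq> D" for E
    proof -
      have "closedin mtopology E"
        unfolding closedin_metric
      proof (intro conjI allI impI)
        show "E \<subseteq> M" using E DM by blast
        fix x assume x: "x \<in> M - E"
        show "\<exists>r>0. disjnt E (mball x r)"
        proof (cases "\<exists>y\<in>E. d x y < e / 2")
          case True
          then obtain y where y: "y \<in> E" "d x y < e / 2" by blast
          have "z \<notin> mball x (d x y)" if z: "z \<in> E" for z
          proof
            assume "z \<in> mball x (d x y)"
            then have "z \<noteq> y" "d x z < e / 2" using y by auto
            moreover have "d y z \<le> d x y + d x z"
              using triangle''[of y x z] x y z E DM by auto
            moreover have "e \<le> d y z"
              using D subsetD[OF E y(1)] subsetD[OF E z] \<open>z \<noteq> y\<close> unfolding sep_def by metis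
            ultimately show False using y by linarith
          qed
          moreover have "0 < d x y" using x y E DM by auto
          ultimately show ?thesis by (intro exI[of _ "d x y"]) (auto simp: disjnt_iff)
        next
          case False
          then show ?thesis using e by (intro exI[of _ "e/2"]) (auto simp: disjnt_iff)
        qed
      qed
      from measurable_sets[OF g closedin_in_sets_borel_of[OF this]] show ?thesis by simp
    qed
    have "\<forall>x\<in>D. \<exists>y. g y = x" using D by (force simp: sep_def)
    then obtain s where s: "\<And>x. x \<in> D \<Longrightarrow> g (s x) = x" by metis
    \<comment> \<open>Points mapped outside \<open>D\<close> share one arbitrary value.\<close>
    define c where "c y = (if g y \<in> D then s (g y) else (\<lambda>_. 0))" for y
    have "countable (range c)"
    proof (rule countable_range_if_all_preimages_borel)
      fix A
      have "c -` A = g -` {x \<in> D. s x \<in> A} \<union> (if (\<lambda>_. 0) \<in> A then - (g -` D) else {})"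
        by (auto simp: c_def split: if_splits)
      then show "c -` A \<in> sets borel" using pre[of D] pre[of "{x \<in> D. s x \<in> A}"] by (auto simp: borel_comp)
    qed
    moreover have "s ` D \<subseteq> range c"
    proof (intro image_subsetI)
      fix x assume "x \<in> D"
      then have "s x = c (s x)" by (simp add: c_def s)
      then show "s x \<in> range c" by blast
    qed
    ultimately have "countable (s ` D)" using countable_subset by blast
    moreover have "inj_on s D" by (metis inj_onI s)
    ultimately show ?thesis by (rule countable_image_inj_on)
  qed
  have "\<exists>D. sep e D \<and> (\<forall>x\<in>range g. \<exists>q\<in>D. d q x < e)" if e: "e > 0" for e
  proof -
    have "\<exists>D\<in>Collect (sep e). \<forall>X\<in>Collect (sep e). D \<subseteq> X \<longrightarrow> X = D"
    proof (rule subset_Zorn_nonempty)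
      show "Collect (sep e) \<noteq> {}" by (auto simp: sep_def intro: exI[of _ "{}"])
      fix \<C> assume "subset.chain (Collect (sep e)) \<C>"
      then have sub: "\<And>D. D \<in> \<C> \<Longrightarrow> sep e D"
        and ch: "\<And>D E. D \<in> \<C> \<Longrightarrow> E \<in> \<C> \<Longrightarrow> D \<subseteq> E \<or> E \<subseteq> D"
        unfolding subset_chain_def by auto
      have "e \<le> d x y" if "x \<in> D" "y \<in> E" "D \<in> \<C>" "E \<in> \<C>" "x \<noteq> y" for x y D E
        using ch[OF that(3,4)] sub[OF that(3)] sub[OF that(4)] that unfolding sep_def by blast
      moreover have "\<Union>\<C> \<subseteq> range g" using sub unfolding sep_def by blast
      ultimately show "\<Union>\<C> \<in> Collect (sep e)" by (auto simp: sep_def)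
    qed
    then obtain D where D: "sep e D" and max: "\<And>X. sep e X \<Longrightarrow> D \<subseteq> X \<Longrightarrow> X = D" by auto
    have "\<exists>q\<in>D. d q x < e" if x: "x \<in> range g" for x
    proof (rule ccontr)
      assume *: "\<not> (\<exists>q\<in>D. d q x < e)"
      then have "sep e (insert x D)" using D x by (auto simp: sep_def commute not_less)
      then have "x \<in> D" using max by blast
      moreover have "d x x = 0" using x gran fM by auto
      ultimately show False using * e by force
    qed
    then show ?thesis using D by blast
  qed
  then have "\<forall>n. \<exists>D. sep (1 / real (Suc n)) D \<and> (\<forall>x\<in>range g. \<exists>q\<in>D. d q x < 1 / real (Suc n))" by simp
  then obtain D where D: "\<And>n. sep (1 / real (Suc n)) (D n)"
    and D_dense: "\<And>n x. x \<in> range g \<Longrightarrow> \<exists>q\<in>D n. d q x < 1 / real (Suc n)" by metis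
  show ?thesis
  proof (intro exI[of _ "\<Union>n. D n"] conjI ballI allI impI)
    show "countable (\<Union>n. D n)" using sep_countable[OF D] by auto
    show "(\<Union>n. D n) \<subseteq> M" using D gran fM by (fastforce simp: sep_def)
    fix t and e :: real assume t: "t \<in> space N" and "e > 0"
    then obtain n where n: "1 / real (Suc n) < e" using nat_approx_posE by blast
    obtain q where "q \<in> D n" "d q (f t) < 1 / real (Suc n)" using D_dense[of "f t" n] t gran by blast
    then show "\<exists>q\<in>\<Union>n. D n. d q (f t) < e" using n by (intro bexI[of _ q]) auto
  qed
qed

section \<open>Pairs of Borel maps\<close>

text \<open>An open set of the product is an arbitrary union of products of balls. On the product of the
  two separable images, the countably many products with centres in the approximating sets and
  radii \<open>1 / (n + 1)\<close> suffice.\<close>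

lemma (in Metric_space) measurable_Pair_borel_of:
  assumes "standard_borel N"
    and f: "f \<in> measurable N (borel_of mtopology)" and g: "g \<in> measurable N (borel_of mtopology)"
  shows "(\<lambda>t. (f t, g t)) \<in> measurable N (borel_of (prod_topology mtopology mtopology))"
proof (rule measurable_borel_ofI)
  have fM: "f t \<in> M" and gM: "g t \<in> M" if "t \<in> space N" for t
    using measurable_space[OF f that] measurable_space[OF g that] by simp_all
  then show "(\<lambda>t. (f t, g t)) \<in> space N \<rightarrow> topspace (prod_topology mtopology mtopology)" by auto
  fix W assume W: "openin (prod_topology mtopology mtopology) W"
  obtain Q where Q: "countable Q" "Q \<subseteq> M" "\<And>t e. t \<in> space N \<Longrightarrow> e > 0 \<Longrightarrow> \<exists>q\<in>Q. d q (f t) < e"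
    using measurable_image_separable[OF assms(1) f] by blast
  obtain R where R: "countable R" "R \<subseteq> M" "\<And>t e. t \<in> space N \<Longrightarrow> e > 0 \<Longrightarrow> \<exists>q\<in>R. d q (g t) < e"
    using measurable_image_separable[OF assms(1) g] by blast
  define I where "I = {(q, r, n) \<in> Q \<times> R \<times> UNIV.
      mball q (1 / real (Suc n)) \<times> mball r (1 / real (Suc n)) \<subseteq> W}"
  define B where "B = (\<lambda>(q, r, n :: nat). (f -` mball q (1 / real (Suc n)) \<inter> space N)
      \<inter> (g -` mball r (1 / real (Suc n)) \<inter> space N))"
  have "I \<subseteq> Q \<times> R \<times> UNIV" by (auto simp: I_def)
  then have "countable I" by (rule countable_subset) (use Q(1) R(1) in auto)
  moreover have "B i \<in> sets N" for i
    using measurable_sets[OF f openin_in_sets_borel_of[OF openin_mball]]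
      measurable_sets[OF g openin_in_sets_borel_of[OF openin_mball]]
    by (auto simp: B_def split: prod.split)
  moreover have "(\<lambda>t. (f t, g t)) -` W \<inter> space N = (\<Union>i\<in>I. B i)"
  proof (intro equalityI subsetI)
    fix t assume "t \<in> (\<lambda>t. (f t, g t)) -` W \<inter> space N"
    then have t: "t \<in> space N" "(f t, g t) \<in> W" by auto
    then obtain U V where UV: "openin mtopology U" "openin mtopology V" "f t \<in> U" "g t \<in> V" "U \<times> V \<subseteq> W"
      using W[unfolded openin_prod_topology_alt, rule_format, OF t(2)] by (elim exE conjE) (rule that)
    obtain r1 where r1: "r1 > 0" "mball (f t) r1 \<subseteq> U" using UV unfolding openin_mtopology by blast
    obtain r2 where r2: "r2 > 0" "mball (g t) r2 \<subseteq> V" using UV unfolding openin_mtopology by blast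
    obtain n where n: "1 / real (Suc n) < min r1 r2 / 2"
      using nat_approx_posE[of "min r1 r2 / 2"] r1 r2 by auto
    obtain q where q: "q \<in> Q" "d q (f t) < 1 / real (Suc n)" using Q(3)[OF t(1), of "1 / real (Suc n)"] by auto
    obtain r where r: "r \<in> R" "d r (g t) < 1 / real (Suc n)" using R(3)[OF t(1), of "1 / real (Suc n)"] by auto
    have "mball q (1 / real (Suc n)) \<subseteq> mball (f t) r1"
      by (rule mball_subset[OF _ fM[OF t(1)]]) (use q(2) n in linarith)
    moreover have "mball r (1 / real (Suc n)) \<subseteq> mball (g t) r2"
      by (rule mball_subset[OF _ gM[OF t(1)]]) (use r(2) n in linarith)
    ultimately have "mball q (1 / real (Suc n)) \<times> mball r (1 / real (Suc n)) \<subseteq> W"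
      using UV(5) r1(2) r2(2) by blast
    then have "(q, r, n) \<in> I" using q(1) r(1) by (simp add: I_def)
    moreover have "t \<in> B (q, r, n)"
      using q r t fM[OF t(1)] gM[OF t(1)] Q(2) R(2) by (auto simp: B_def)
    ultimately show "t \<in> (\<Union>i\<in>I. B i)" by blast
  qed (auto simp: I_def B_def)
  ultimately show "(\<lambda>t. (f t, g t)) -` W \<inter> space N \<in> sets N" by auto
qed

text \<open>The distance is continuous on the product, so this follows from the measurability of the
  pair.\<close>

lemma (in Metric_space) borel_measurable_distance:
  assumes "standard_borel N"
    and "f \<in> measurable N (borel_of mtopology)" and "g \<in> measurable N (borel_of mtopology)"
  shows "(\<lambda>t. d (f t) (g t)) \<in> borel_measurable N"
proof (rule borel_measurableI_less)
  fix a
  let ?W = "{p \<in> M \<times> M. d (fst p) (snd p) < a}"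
  have "openin (prod_topology mtopology mtopology) ?W"
    unfolding openin_prod_topology_alt
  proof (intro allI impI)
    fix x y assume "(x, y) \<in> ?W"
    then have xy: "x \<in> M" "y \<in> M" "d x y < a" by auto
    define r where "r = (a - d x y) / 2"
    have r: "r > 0" "a = d x y + 2 * r" using xy by (auto simp: r_def field_simps)
    have "d u v < a" if "u \<in> mball x r" "v \<in> mball y r" for u v
    proof -
      have "d u v \<le> d u x + d x v" "d x v \<le> d x y + d y v" using that by (auto intro: triangle)
      moreover have "d u x < r" "d y v < r" using that by (auto simp: commute)
      ultimately show ?thesis using r(2) by linarith
    qed
    then have "mball x r \<times> mball y r \<subseteq> ?W" by auto
    then show "\<exists>U V. openin mtopology U \<and> openin mtopology V \<and> x \<in> U \<and> y \<in> V \<and> U \<times> V \<subseteq> ?W"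
      using xy r(1) by (intro exI[of _ "mball x r"] exI[of _ "mball y r"]) (simp del: in_mball)
  qed
  from measurable_sets[OF measurable_Pair_borel_of[OF assms] openin_in_sets_borel_of[OF this]]
  have "(\<lambda>t. (f t, g t)) -` ?W \<inter> space N \<in> sets N" .
  moreover have "(\<lambda>t. (f t, g t)) -` ?W \<inter> space N = {t \<in> space N. d (f t) (g t) < a}"
    using measurable_space[OF assms(2)] measurable_space[OF assms(3)] by auto
  ultimately show "{t \<in> space N. d (f t) (g t) < a} \<in> sets N" by simp
qed

section \<open>Bi-invariant distances\<close>

lemma metric_group_bi_invariant_iff:
  assumes "metric_group G d"
  shows "bi_invariant G d \<longleftrightarrow>
    (\<forall>g\<in>carrier G. \<forall>x\<in>carrier G. \<forall>y\<in>carrier G. d (x \<otimes>\<^bsub>G\<^esub> g) (y \<otimes>\<^bsub>G\<^esub> g) = d x y)"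
  using assms unfolding metric_group_def bi_invariant_def by blast

lemma bi_invariant_if_comm_group:
  assumes "metric_group G d" "comm_group G"
  shows "bi_invariant G d"
proof -
  interpret comm_group G by fact
  show ?thesis
    using assms(1) m_comm unfolding metric_group_bi_invariant_iff[OF assms(1)] metric_group_def by metis
qed

text \<open>Right translations are injective, and injections preserve the discrete metric.\<close>

lemma bi_invariant_if_discrete_metric:
  assumes "metric_group G d" "is_discrete_metric (carrier G) d"
  shows "bi_invariant G d"
proof -
  interpret group G using assms(1) by (simp add: metric_group_def topological_group_def)
  show ?thesis
    using assms(2) unfolding metric_group_bi_invariant_iff[OF assms(1)] is_discrete_metric_def
    by (simp add: discrete_metric.dd_def)
qed

locale bi_invariant_metric_group =
  Metric_space "carrier G" d + group G
  for G :: "('a, 'b) monoid_scheme" (structure) and d +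
  assumes mult_continuous: "continuous_map (prod_topology mtopology mtopology) mtopology (\<lambda>(x, y). x \<otimes> y)"
    and inv_continuous: "continuous_map mtopology mtopology (\<lambda>x. inv x)"
    and left_invariant: "\<lbrakk>g \<in> carrier G; x \<in> carrier G; y \<in> carrier G\<rbrakk> \<Longrightarrow> d (g \<otimes> x) (g \<otimes> y) = d x y"
    and right_invariant: "\<lbrakk>g \<in> carrier G; x \<in> carrier G; y \<in> carrier G\<rbrakk> \<Longrightarrow> d (x \<otimes> g) (y \<otimes> g) = d x y"
begin

lemma dist_mult_le:
  assumes "x \<in> carrier G" "y \<in> carrier G" "x' \<in> carrier G" "y' \<in> carrier G"
  shows "d (x \<otimes> y) (x' \<otimes> y') \<le> d x x' + d y y'"
proof -
  have "d (x \<otimes> y) (x' \<otimes> y') \<le> d (x \<otimes> y) (x' \<otimes> y) + d (x' \<otimes> y) (x' \<otimes> y')"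
    using assms by (intro triangle) auto
  then show ?thesis using assms by (simp add: left_invariant right_invariant)
qed

lemma dist_inv:
  assumes "x \<in> carrier G" "y \<in> carrier G"
  shows "d (inv x) (inv y) = d x y"
proof -
  have "d (inv x) (inv y) = d (x \<otimes> inv x) (x \<otimes> inv y)"
    using assms by (intro left_invariant[symmetric]) auto
  also have "\<dots> = d (x \<otimes> inv x \<otimes> y) (x \<otimes> inv y \<otimes> y)"
    using assms by (intro right_invariant[symmetric]) auto
  also have "\<dots> = d y x" using assms by (simp add: m_assoc)
  finally show ?thesis by (simp add: commute)
qed

end

section \<open>The group of classes of integrable Borel maps\<close>

locale bi_invariant_L = bi_invariant_metric_group G d + prob_space M
  for G :: "('a, 'b) monoid_scheme" (structure) and d and M +
  assumes standard_borel: "standard_borel M"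
begin

abbreviation L where "L \<equiv> L_maps M G d"
abbreviation cls where "cls f \<equiv> L_eq M G d `` {f}"
abbreviation LG where "LG \<equiv> L_group M G d"
abbreviation D where "D \<equiv> L_dist M G d"

lemma L_measurable: "f \<in> L \<Longrightarrow> f \<in> measurable M (borel_of mtopology)"
  by (simp add: L_maps_def)

lemma L_carrier: "f \<in> L \<Longrightarrow> t \<in> space M \<Longrightarrow> f t \<in> carrier G"
  using measurable_space[OF L_measurable] by fastforce

lemma L_dist_measurable: "f \<in> L \<Longrightarrow> g \<in> L \<Longrightarrow> (\<lambda>t. d (f t) (g t)) \<in> borel_measurable M"
  by (intro borel_measurable_distance standard_borel L_measurable)

text \<open>Domination by the distances of the two maps to the neutral element.\<close>

lemma L_dist_integrable:
  assumes "f \<in> L" "g \<in> L"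
  shows "integrable M (\<lambda>t. d (f t) (g t))"
proof (rule Bochner_Integration.integrable_bound)
  show "integrable M (\<lambda>t. d (f t) \<one> + d (g t) \<one>)" using assms by (simp add: L_maps_def)
  show "AE t in M. norm (d (f t) (g t)) \<le> norm (d (f t) \<one> + d (g t) \<one>)"
    using triangle'[OF L_carrier[OF assms(1)] one_closed L_carrier[OF assms(2)]] by (intro AE_I2) auto
qed (rule L_dist_measurable[OF assms])

lemma L_one: "(\<lambda>t. \<one>) \<in> L"
  by (simp add: L_maps_def)

text \<open>Joint measurability of \<open>f\<close> and \<open>g\<close> makes the product Borel, and \<open>d (xy) 1 \<le> d x 1 + d y 1\<close>
  makes it integrable.\<close>

lemma L_mult:
  assumes "f \<in> L" "g \<in> L"
  shows "(\<lambda>t. f t \<otimes> g t) \<in> L"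
proof -
  have "(\<lambda>t. case (f t, g t) of (x, y) \<Rightarrow> x \<otimes> y) \<in> measurable M (borel_of mtopology)"
    by (rule measurable_compose[OF measurable_Pair_borel_of continuous_map_imp_measurable[OF mult_continuous]])
       (intro standard_borel L_measurable assms)+
  then have meas: "(\<lambda>t. f t \<otimes> g t) \<in> measurable M (borel_of mtopology)" by simp
  have "integrable M (\<lambda>t. d (f t \<otimes> g t) \<one>)"
  proof (rule Bochner_Integration.integrable_bound)
    show "integrable M (\<lambda>t. d (f t) \<one> + d (g t) \<one>)" using assms by (simp add: L_maps_def)
    show "(\<lambda>t. d (f t \<otimes> g t) \<one>) \<in> borel_measurable M"
      by (intro borel_measurable_distance standard_borel meas L_measurable L_one)
    show "AE t in M. norm (d (f t \<otimes> g t) \<one>) \<le> norm (d (f t) \<one> + d (g t) \<one>)"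
      using dist_mult_le[OF L_carrier[OF assms(1)] L_carrier[OF assms(2)] one_closed one_closed]
      by (intro AE_I2) auto
  qed
  then show ?thesis using meas by (simp add: L_maps_def)
qed

lemma L_inv:
  assumes "f \<in> L"
  shows "(\<lambda>t. inv (f t)) \<in> L"
proof -
  have "(\<lambda>t. inv (f t)) \<in> measurable M (borel_of mtopology)"
    using measurable_compose[OF L_measurable[OF assms] continuous_map_imp_measurable[OF inv_continuous]] .
  moreover have "integrable M (\<lambda>t. d (inv (f t)) \<one>) \<longleftrightarrow> integrable M (\<lambda>t. d (f t) \<one>)"
    by (intro Bochner_Integration.integrable_cong refl) (use dist_inv[OF L_carrier[OF assms] one_closed] in simp)
  ultimately show ?thesis using assms by (simp add: L_maps_def)
qed

lemma equiv_L_eq: "equiv L (L_eq M G d)"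
proof (rule equivI)
  show "refl_on L (L_eq M G d)" by (auto simp: refl_on_def L_eq_def)
  show "sym (L_eq M G d)" by (auto simp: sym_def L_eq_def elim: eventually_mono)
  show "trans (L_eq M G d)"
    unfolding trans_def L_eq_def by (auto elim: eventually_elim2)
  show "L_eq M G d \<subseteq> L \<times> L" by (auto simp: L_eq_def)
qed

lemma cls_eq_iff: "f \<in> L \<Longrightarrow> g \<in> L \<Longrightarrow> cls f = cls g \<longleftrightarrow> (AE t in M. f t = g t)"
  using eq_equiv_class_iff[OF equiv_L_eq, of f g] by (simp add: L_eq_def)

lemma carrier_L_group: "carrier LG = cls ` L"
  by (auto simp: L_group_def quotient_def)

lemma one_L_group: "\<one>\<^bsub>LG\<^esub> = cls (\<lambda>t. \<one>)"
  by (simp add: L_group_def)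

lemma mult_cls:
  assumes "f \<in> L" "g \<in> L"
  shows "cls f \<otimes>\<^bsub>LG\<^esub> cls g = cls (\<lambda>t. f t \<otimes> g t)"
proof -
  have "cls (\<lambda>t. f' t \<otimes> g' t) = cls (\<lambda>t. f t \<otimes> g t)" if "f' \<in> cls f" "g' \<in> cls g" for f' g'
  proof -
    have "f' \<in> L" "g' \<in> L" "AE t in M. f t = f' t" "AE t in M. g t = g' t"
      using that by (simp_all add: L_eq_def)
    moreover from this(3,4) have "AE t in M. f' t \<otimes> g' t = f t \<otimes> g t" by eventually_elim simp
    ultimately show ?thesis using assms by (simp add: cls_eq_iff L_mult)
  qed
  moreover have "f \<in> cls f" "g \<in> cls g" using assms by (simp_all add: L_eq_def)
  moreover have "cls f \<otimes>\<^bsub>LG\<^esub> cls g = (\<Union>f'\<in>cls f. \<Union>g'\<in>cls g. cls (\<lambda>t. f' t \<otimes> g' t))"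
    by (simp add: L_group_def)
  ultimately show ?thesis by blast
qed

lemma group_L_group: "group LG"
proof (rule groupI)
  show "\<one>\<^bsub>LG\<^esub> \<in> carrier LG" using L_one by (simp add: carrier_L_group one_L_group)
  fix A assume "A \<in> carrier LG"
  then obtain f where f: "f \<in> L" "A = cls f" by (auto simp: carrier_L_group)
  have "cls (\<lambda>t. \<one> \<otimes> f t) = cls f"
    using f L_one L_carrier by (subst cls_eq_iff) (auto intro!: L_mult AE_I2)
  then show "\<one>\<^bsub>LG\<^esub> \<otimes>\<^bsub>LG\<^esub> A = A" using f L_one by (simp add: one_L_group mult_cls)
  have "cls (\<lambda>t. inv (f t) \<otimes> f t) = cls (\<lambda>t. \<one>)"
    using f L_one L_carrier by (subst cls_eq_iff) (auto intro!: L_mult L_inv AE_I2)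
  then have "cls (\<lambda>t. inv (f t)) \<otimes>\<^bsub>LG\<^esub> A = \<one>\<^bsub>LG\<^esub>" using f by (simp add: one_L_group mult_cls L_inv)
  then show "\<exists>B\<in>carrier LG. B \<otimes>\<^bsub>LG\<^esub> A = \<one>\<^bsub>LG\<^esub>" using L_inv[OF f(1)] by (auto simp: carrier_L_group)
  fix B assume "B \<in> carrier LG"
  then obtain g where g: "g \<in> L" "B = cls g" by (auto simp: carrier_L_group)
  show "A \<otimes>\<^bsub>LG\<^esub> B \<in> carrier LG" using f g by (simp add: mult_cls carrier_L_group L_mult)
  fix C assume "C \<in> carrier LG"
  then obtain h where h: "h \<in> L" "C = cls h" by (auto simp: carrier_L_group)
  have "cls (\<lambda>t. f t \<otimes> g t \<otimes> h t) = cls (\<lambda>t. f t \<otimes> (g t \<otimes> h t))"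
    using f g h L_carrier by (subst cls_eq_iff) (auto intro!: L_mult AE_I2 m_assoc)
  then show "A \<otimes>\<^bsub>LG\<^esub> B \<otimes>\<^bsub>LG\<^esub> C = A \<otimes>\<^bsub>LG\<^esub> (B \<otimes>\<^bsub>LG\<^esub> C)"
    using f g h by (simp add: mult_cls L_mult)
qed

lemma inv_cls:
  assumes "f \<in> L"
  shows "inv\<^bsub>LG\<^esub> (cls f) = cls (\<lambda>t. inv (f t))"
proof (rule group.inv_equality[OF group_L_group])
  have "cls (\<lambda>t. inv (f t) \<otimes> f t) = cls (\<lambda>t. \<one>)"
    using assms L_one L_carrier by (subst cls_eq_iff) (auto intro!: L_mult L_inv AE_I2)
  then show "cls (\<lambda>t. inv (f t)) \<otimes>\<^bsub>LG\<^esub> cls f = \<one>\<^bsub>LG\<^esub>"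
    using assms by (simp add: one_L_group mult_cls L_inv)
  show "cls f \<in> carrier LG" using assms by (simp add: carrier_L_group)
  show "cls (\<lambda>t. inv (f t)) \<in> carrier LG" using L_inv[OF assms] by (simp add: carrier_L_group)
qed

lemma dist_cls:
  assumes "f \<in> L" "g \<in> L"
  shows "D (cls f) (cls g) = (\<integral>t. d (f t) (g t) \<partial>M)"
proof -
  have "(\<integral>t. d (f' t) (g' t) \<partial>M) = (\<integral>t. d (f t) (g t) \<partial>M)" if "f' \<in> cls f" "g' \<in> cls g" for f' g'
  proof (rule integral_cong_AE)
    have *: "f' \<in> L" "g' \<in> L" "AE t in M. f t = f' t" "AE t in M. g t = g' t"
      using that by (simp_all add: L_eq_def)
    show "(\<lambda>t. d (f' t) (g' t)) \<in> borel_measurable M" "(\<lambda>t. d (f t) (g t)) \<in> borel_measurable M"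
      using * assms by (auto intro: L_dist_measurable)
    show "AE t in M. d (f' t) (g' t) = d (f t) (g t)" using *(3,4) by eventually_elim simp
  qed
  moreover have "f \<in> cls f" "g \<in> cls g" using assms by (simp_all add: L_eq_def)
  ultimately have "(\<Union>f'\<in>cls f. \<Union>g'\<in>cls g. {\<integral>t. d (f' t) (g' t) \<partial>M}) = {\<integral>t. d (f t) (g t) \<partial>M}"
    by blast
  then show ?thesis using assms by (simp add: L_dist_def carrier_L_group)
qed

text \<open>The integral of the nonnegative function \<open>t \<mapsto> d (f t) (g t)\<close> vanishes iff the function
  vanishes almost everywhere, which is how the classes are formed.\<close>

lemma Metric_space_L_dist: "Metric_space (carrier LG) D"
proof
  show "0 \<le> D A B" for A B
  proof (cases "A \<in> carrier LG \<and> B \<in> carrier LG")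
    case True
    then show ?thesis by (auto simp: carrier_L_group dist_cls intro!: integral_nonneg_AE)
  next
    case False
    then show ?thesis by (simp only: L_dist_def if_False order_refl)
  qed
  show "D A B = D B A" for A B
  proof (cases "A \<in> carrier LG \<and> B \<in> carrier LG")
    case True
    then show ?thesis by (auto simp: carrier_L_group dist_cls commute)
  next
    case False
    then have "\<not> (B \<in> carrier LG \<and> A \<in> carrier LG)" by blast
    with False show ?thesis by (simp only: L_dist_def if_False)
  qed
  fix A B assume "A \<in> carrier LG" "B \<in> carrier LG"
  then obtain f g where fg: "f \<in> L" "g \<in> L" "A = cls f" "B = cls g" by (auto simp: carrier_L_group)
  have "D A B = 0 \<longleftrightarrow> (AE t in M. d (f t) (g t) = 0)"
    using fg by (simp add: dist_cls integral_nonneg_eq_0_iff_AE L_dist_integrable)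
  also have "\<dots> \<longleftrightarrow> (AE t in M. f t = g t)"
    using fg L_carrier by (intro AE_cong) auto
  finally show "D A B = 0 \<longleftrightarrow> A = B" using fg by (simp add: cls_eq_iff)
  fix C assume "C \<in> carrier LG"
  then obtain h where h: "h \<in> L" "C = cls h" by (auto simp: carrier_L_group)
  have "(\<integral>t. d (f t) (h t) \<partial>M) \<le> (\<integral>t. d (f t) (g t) + d (g t) (h t) \<partial>M)"
    using fg h L_carrier by (intro integral_mono) (auto intro!: L_dist_integrable triangle)
  then show "D A C \<le> D A B + D B C" using fg h by (simp add: dist_cls L_dist_integrable)
qed

lemma dist_mult_cls_le:
  assumes "A \<in> carrier LG" "B \<in> carrier LG" "A' \<in> carrier LG" "B' \<in> carrier LG"
  shows "D (A \<otimes>\<^bsub>LG\<^esub> B) (A' \<otimes>\<^bsub>LG\<^esub> B') \<le> D A A' + D B B'"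
proof -
  obtain f g f' g' where *: "f \<in> L" "g \<in> L" "f' \<in> L" "g' \<in> L"
    and cls: "A = cls f" "B = cls g" "A' = cls f'" "B' = cls g'"
    using assms by (auto simp: carrier_L_group)
  have "(\<integral>t. d (f t \<otimes> g t) (f' t \<otimes> g' t) \<partial>M) \<le> (\<integral>t. d (f t) (f' t) + d (g t) (g' t) \<partial>M)"
    using * L_carrier by (intro integral_mono) (auto intro!: L_dist_integrable L_mult dist_mult_le)
  then show ?thesis using * by (simp add: cls mult_cls dist_cls L_mult L_dist_integrable)
qed

lemma dist_inv_cls:
  assumes "A \<in> carrier LG" "B \<in> carrier LG"
  shows "D (inv\<^bsub>LG\<^esub> A) (inv\<^bsub>LG\<^esub> B) = D A B"
proof -
  obtain f g where *: "f \<in> L" "g \<in> L" "A = cls f" "B = cls g"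
    using assms by (auto simp: carrier_L_group)
  have "(\<integral>t. d (inv (f t)) (inv (g t)) \<partial>M) = (\<integral>t. d (f t) (g t) \<partial>M)"
    using * L_carrier by (intro Bochner_Integration.integral_cong refl dist_inv) auto
  then show ?thesis using * by (simp add: inv_cls dist_cls L_inv)
qed

text \<open>Multiplication is Lipschitz for the sum of the distances of the factors, hence the radii
  \<open>e / 2\<close>, and inversion is an isometry.\<close>

lemma topological_group_L_group: "topological_group LG (metric_topology LG D)"
proof -
  interpret LM: Metric_space "carrier LG" D by (rule Metric_space_L_dist)
  interpret LG: group LG by (rule group_L_group)
  have "continuous_map (prod_topology LM.mtopology LM.mtopology) LM.mtopology (\<lambda>(A, B). A \<otimes>\<^bsub>LG\<^esub> B)"
    unfolding LM.continuous_map_to_metric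
  proof (intro ballI allI impI)
    fix p and e :: real
    assume "p \<in> topspace (prod_topology LM.mtopology LM.mtopology)" and e: "e > 0"
    then obtain A B where p: "p = (A, B)" "A \<in> carrier LG" "B \<in> carrier LG" by auto
    let ?U = "LM.mball A (e / 2) \<times> LM.mball B (e / 2)"
    have "A' \<otimes>\<^bsub>LG\<^esub> B' \<in> LM.mball (A \<otimes>\<^bsub>LG\<^esub> B) e"
      if "A' \<in> LM.mball A (e / 2)" "B' \<in> LM.mball B (e / 2)" for A' B'
      using that dist_mult_cls_le[of A B A' B'] by auto
    then show "\<exists>U. openin (prod_topology LM.mtopology LM.mtopology) U \<and> p \<in> U \<and>
        (\<forall>q\<in>U. (case q of (A, B) \<Rightarrow> A \<otimes>\<^bsub>LG\<^esub> B) \<in> LM.mball (case p of (A, B) \<Rightarrow> A \<otimes>\<^bsub>LG\<^esub> B) e)"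
      using p e by (intro exI[of _ ?U]) (auto simp: openin_prod_Times_iff simp del: LM.in_mball)
  qed
  moreover have "continuous_map LM.mtopology LM.mtopology (\<lambda>A. inv\<^bsub>LG\<^esub> A)"
    unfolding LM.continuous_map_to_metric
  proof (intro ballI allI impI)
    fix A and e :: real
    assume "A \<in> topspace LM.mtopology" and e: "e > 0"
    then show "\<exists>U. openin LM.mtopology U \<and> A \<in> U \<and> (\<forall>B\<in>U. inv\<^bsub>LG\<^esub> B \<in> LM.mball (inv\<^bsub>LG\<^esub> A) e)"
      by (intro exI[of _ "LM.mball A e"]) (auto simp: dist_inv_cls)
  qed
  ultimately show ?thesis
    unfolding topological_group_def using group_L_group by simp
qed

lemma L_group_is_topological_group: "L_is_topological_group M G d"
  unfolding L_is_topological_group_def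
  by (intro conjI ballI L_mult mult_cls Metric_space_L_dist topological_group_L_group)

end

theorem proposition4p12:
  fixes M :: "'w measure" and G :: "('a, 'b) monoid_scheme" and d :: "'a \<Rightarrow> 'a \<Rightarrow> real"
  assumes "standard_borel M" and "uncountable (space M)"
    and "prob_space M" and "nonatomic M"
    and "metric_group G d"
  shows "(bi_invariant G d \<longrightarrow> L_is_topological_group M G d) \<and>
    (comm_group G \<or> is_discrete_metric (carrier G) d \<longrightarrow>
       bi_invariant G d \<and> L_is_topological_group M G d)"
proof -
  have main: "L_is_topological_group M G d" if bi: "bi_invariant G d"
  proof -
    have top: "Metric_space (carrier G) d" "topological_group G (metric_topology G d)"
      using assms(5) by (auto simp: metric_group_def)
    have "bi_invariant_metric_group G d"
      using top bi
      by (auto simp: bi_invariant_metric_group_def bi_invariant_metric_group_axioms_def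
          topological_group_def bi_invariant_def)
    then interpret bi_invariant_L G d M
      using assms(1,3) by (simp add: bi_invariant_L_def bi_invariant_L_axioms_def)
    show ?thesis by (rule L_group_is_topological_group)
  qed
  then show ?thesis
    using bi_invariant_if_comm_group[OF assms(5)] bi_invariant_if_discrete_metric[OF assms(5)] by blast
qed

end
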